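(* Let $d\ge 1$ and let $A$ be a non-trivial finitely generated abelian group. If the wreath product $A\wr\mathbb{Z}^d$ embeds into the topological full group of a $\mathbb{Z}$-action on the Cantor set, then $A$ is finite and $d=1$.
   Context: The wreath product $A\wr B$ is the semidirect product $\left(\bigoplus_B A\right)\rtimes B$, where $\bigoplus_B A$ is the group of finitely supported functions $B\to A$ and $B$ acts by $(b\cdot\varphi)(b')=\varphi(b^{-1}b')$. Given an action of a group $G$ by homeomorphisms on the Cantor set $\mathfrak{C}$, the topological full group of the action is the group of all homeomorphisms of $\mathfrak{C}$ that locally coincide with elements of $G$ (i.e. every point of $\mathfrak{C}$ has a neighbourhood on which the homeomorphism coincides with the action of some element of $G$). "Embeds" means is isomorphic to a subgroup. *)

theory Defs
  imports "HOL-Analysis.Analysis" "HOL-Algebra.Algebra"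
begin

definition finitely_generated_group :: "('a, 'm) monoid_scheme \<Rightarrow> bool" where
  "finitely_generated_group G \<longleftrightarrow>
     (\<exists>S. finite S \<and> S \<subseteq> carrier G \<and> generate G S = carrier G)"

definition embeds_into :: "('a, 'm) monoid_scheme \<Rightarrow> ('b, 'n) monoid_scheme \<Rightarrow> bool" where
  "embeds_into G H \<longleftrightarrow> (\<exists>K. subgroup K H \<and> G \<cong> H\<lparr>carrier := K\<rparr>)"

definition semidirect_product ::
  "('n, 'm) monoid_scheme \<Rightarrow> ('h, 'k) monoid_scheme \<Rightarrow> ('h \<Rightarrow> 'n \<Rightarrow> 'n) \<Rightarrow> ('n \<times> 'h) monoid" where
  "semidirect_product N H \<alpha> =
     \<lparr>carrier = carrier N \<times> carrier H,
      mult = (\<lambda>(n, h) (n', h'). (n \<otimes>\<^bsub>N\<^esub> \<alpha> h n', h \<otimes>\<^bsub>H\<^esub> h')),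
      one = (\<one>\<^bsub>N\<^esub>, \<one>\<^bsub>H\<^esub>)\<rparr>"

text \<open>Elements of \<open>sum_group (carrier B) (\<lambda>_. A)\<close> are functions that are \<open>undefined\<close> outside
  \<open>carrier B\<close>, hence the restriction in the shift.\<close>

definition wreath_product ::
  "('a, 'm) monoid_scheme \<Rightarrow> ('b, 'n) monoid_scheme \<Rightarrow> (('b \<Rightarrow> 'a) \<times> 'b) monoid" where
  "wreath_product A B =
     semidirect_product (sum_group (carrier B) (\<lambda>_. A)) B
       (\<lambda>b \<phi>. \<lambda>b'\<in>carrier B. \<phi> (inv\<^bsub>B\<^esub> b \<otimes>\<^bsub>B\<^esub> b'))"

definition free_abelian_of_rank :: "nat \<Rightarrow> (nat \<Rightarrow> int) monoid" where
  "free_abelian_of_rank d = product_group {..<d} (\<lambda>_. integer_group)"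

text \<open>Any space homeomorphic to the product of countably many two-point discrete spaces counts
  as the Cantor set.\<close>

definition cantor_space :: "'x topology \<Rightarrow> bool" where
  "cantor_space T \<longleftrightarrow>
     T homeomorphic_space
       product_topology (\<lambda>_. discrete_topology (UNIV :: bool set)) (UNIV :: nat set)"

definition action_by_homeomorphisms ::
  "('g, 'm) monoid_scheme \<Rightarrow> 'x topology \<Rightarrow> ('g \<Rightarrow> 'x \<Rightarrow> 'x) \<Rightarrow> bool" where
  "action_by_homeomorphisms G T \<alpha> \<longleftrightarrow>
     group_action G (topspace T) \<alpha> \<and> (\<forall>g\<in>carrier G. homeomorphic_map T T (\<alpha> g))"

text \<open>As in \<open>BijGroup\<close>, maps are \<open>undefined\<close> outside \<open>topspace T\<close>, so each homeomorphism is
  represented by exactly one element; the group operation is composition.\<close>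

definition topological_full_group ::
  "('g, 'm) monoid_scheme \<Rightarrow> 'x topology \<Rightarrow> ('g \<Rightarrow> 'x \<Rightarrow> 'x) \<Rightarrow> ('x \<Rightarrow> 'x) monoid" where
  "topological_full_group G T \<alpha> =
     BijGroup (topspace T)
       \<lparr>carrier := {h \<in> Bij (topspace T). homeomorphic_map T T h \<and>
          (\<forall>x\<in>topspace T. \<exists>U g. openin T U \<and> x \<in> U \<and> g \<in> carrier G \<and>
             (\<forall>y\<in>U. h y = \<alpha> g y))}\<rparr>"

end

(* Every element of the full group moves points by a bounded number of steps along the Z-orbits, so
   orbits of finitely generated subgroups grow at most linearly. By pigeonhole, for p, q in the
   wreath product G there is a finite set of words (p^i q^j)^-1 p^k q^l with (i, j) <> (k, l), one
   of which fixes any given point. For d >= 2 take for p, q two standard generators of Z^d, so that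
   all these words lie outside the lamp group L; for A infinite take a generator of Z^d and a lamp q
   of infinite order, so that the words inside L are non-zero powers of q.

   Let T be the finite set of those words outside L. If every point of the L-orbit of x is fixed by
   an element of T, then L is covered by card T classes; as in B. H. Neumann's
   lemma, one class has index at most card T, and because the stabiliser of x contains some s in T,
   writing L additively, (t - 1)(s^N - 1) L fixes x for N = (card T)!. If no point
   of the G-orbit of x has this property, then all conjugates of q^(n!) fix x. The product of all such
   operators is injective on L, so in either case the element it produces from a suitable non-trivial
   lamp fixes every point without being trivial, contradicting faithfulness. *)

theory Submission
  imports Defs
begin

section \<open>Finite coverings and finite generation in abelian groups\<close>

lemma (in group) mult_inv_cancel:
  assumes "x \<in> carrier G" "y \<in> carrier G"
  shows "x \<otimes> (inv x \<otimes> y) = y" "inv x \<otimes> (x \<otimes> y) = y"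
  using assms by (simp_all flip: m_assoc)

text \<open>A counting form of B. H. Neumann's covering lemma in which the classes
  \<open>C t\<close> are arbitrary subsets. With m = \<open>card T\<close>, suppose that every
  \<open>t\<close> had a sequence of m + 1 elements violating the claim. Of the (m+1)^m ways to
  multiply one term from each sequence, each \<open>C t\<close> would receive at most (m+1)^(m-1),
  too few for m classes to cover everything.\<close>

lemma (in comm_group) finite_cover_common_class:
  fixes C :: "'t \<Rightarrow> 'a set"
  assumes "finite T"
    and cover: "carrier G \<subseteq> (\<Union>t\<in>T. C t)"
  shows "\<exists>t\<in>T. \<forall>e. (\<forall>i\<le>card T. e i \<in> carrier G) \<longrightarrow>
           (\<exists>i j. i < j \<and> j \<le> card T \<and> (\<exists>f\<in>carrier G \<inter> C t. \<exists>g\<in>carrier G \<inter> C t. e i \<otimes> inv (e j) = f \<otimes> inv g))"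
proof (rule ccontr)
  assume "\<not> ?thesis"
  then obtain e :: "'t \<Rightarrow> nat \<Rightarrow> 'a"
    where e: "\<And>t i. \<lbrakk>t \<in> T; i \<le> card T\<rbrakk> \<Longrightarrow> e t i \<in> carrier G"
      and sep: "\<And>t i j f g. \<lbrakk>t \<in> T; i < j; j \<le> card T; f \<in> carrier G \<inter> C t; g \<in> carrier G \<inter> C t\<rbrakk>
                  \<Longrightarrow> e t i \<otimes> inv (e t j) \<noteq> f \<otimes> inv g"
    by (metis (no_types, lifting) bchoice)
  \<comment> \<open>\<open>sep\<close> treats only \<open>i < j\<close>; inverting the equation
    exchanges \<open>f\<close> and \<open>g\<close> and settles the other order.\<close>
  have sep': "i = j" if t: "t \<in> T" and ij: "i \<le> card T" "j \<le> card T"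
    and fg: "f \<in> carrier G \<inter> C t" "g \<in> carrier G \<inter> C t" and eq: "e t i \<otimes> inv (e t j) = f \<otimes> inv g"
    for t i j f g
  proof (rule ccontr)
    assume "i \<noteq> j"
    moreover have "e t j \<otimes> inv (e t i) = g \<otimes> inv f"
    proof -
      have "inv (e t i \<otimes> inv (e t j)) = inv (f \<otimes> inv g)" using eq by simp
      then show ?thesis
        using e[OF t] ij fg by (simp add: inv_mult_group)
    qed
    ultimately show False
      using sep[OF t, of i j f g] sep[OF t, of j i g f] ij fg eq by (meson linorder_neqE_nat)
  qed
  txt \<open>Choose the terms of a product \<open>\<Otimes>t\<in>T. e t (\<iota> t)\<close> independently: once the other terms are
    chosen, at most one of the \<open>Suc m\<close> values of \<open>\<iota> t\<close> puts the product into \<open>C t\<close>.\<close>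
  define m where "m = card T"
  define I where "I = (\<Pi>\<^sub>E t\<in>T. {..m})"
  define s where "s = (\<lambda>\<iota>. finprod G (\<lambda>t. e t (\<iota> t)) T)"
  define B where "B = (\<lambda>t. {\<iota> \<in> I. s \<iota> \<in> C t})"
  have finI: "finite I" unfolding I_def using \<open>finite T\<close> by (intro finite_PiE) auto
  have s_in: "s \<iota> \<in> carrier G" if "\<iota> \<in> I" for \<iota>
    unfolding s_def using that e by (intro finprod_closed) (auto simp: I_def PiE_iff m_def)
  have I_sub: "I \<subseteq> (\<Union>t\<in>T. B t)"
  proof
    fix \<iota> assume "\<iota> \<in> I"
    then show "\<iota> \<in> (\<Union>t\<in>T. B t)" using s_in cover by (fastforce simp: B_def)
  qed
  have cardB: "card (B t) \<le> Suc m ^ (m - 1)" if t: "t \<in> T" for t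
  proof -
    let ?J = "\<Pi>\<^sub>E u\<in>T - {t}. {..m}"
    let ?r = "\<lambda>\<iota>. restrict \<iota> (T - {t})"
    have split: "s \<iota> = e t (\<iota> t) \<otimes> finprod G (\<lambda>u. e u (\<iota> u)) (T - {t})"
      and rest: "finprod G (\<lambda>u. e u (\<iota> u)) (T - {t}) \<in> carrier G" if "\<iota> \<in> I" for \<iota>
    proof -
      have ev: "e u (\<iota> u) \<in> carrier G" if "u \<in> T" for u
        using that \<open>\<iota> \<in> I\<close> e by (auto simp: I_def PiE_iff m_def)
      have "s \<iota> = finprod G (\<lambda>u. e u (\<iota> u)) (insert t (T - {t}))"
        unfolding s_def using t by (simp add: insert_absorb)
      also have "\<dots> = e t (\<iota> t) \<otimes> finprod G (\<lambda>u. e u (\<iota> u)) (T - {t})"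
        using ev t \<open>finite T\<close> by (intro finprod_insert) auto
      finally show "s \<iota> = e t (\<iota> t) \<otimes> finprod G (\<lambda>u. e u (\<iota> u)) (T - {t})" .
      show "finprod G (\<lambda>u. e u (\<iota> u)) (T - {t}) \<in> carrier G"
        using ev by (intro finprod_closed) auto
    qed
    have "inj_on ?r (B t)"
    proof (rule inj_onI)
      fix \<iota> \<kappa> assume A: "\<iota> \<in> B t" "\<kappa> \<in> B t" and r: "?r \<iota> = ?r \<kappa>"
      then have I: "\<iota> \<in> I" "\<kappa> \<in> I" and C: "s \<iota> \<in> C t" "s \<kappa> \<in> C t" by (auto simp: B_def)
      have agree: "\<iota> u = \<kappa> u" if "u \<in> T - {t}" for u
        using fun_cong[OF r, of u] that by (auto simp: restrict_def split: if_splits)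
      then have fp: "finprod G (\<lambda>u. e u (\<iota> u)) (T - {t}) = finprod G (\<lambda>u. e u (\<kappa> u)) (T - {t})"
        using I e by (intro finprod_cong) (auto simp: I_def PiE_iff m_def simp_implies_def)
      let ?p = "finprod G (\<lambda>u. e u (\<kappa> u)) (T - {t})"
      have ee: "\<iota> t \<le> card T" "\<kappa> t \<le> card T" using I t by (auto simp: I_def PiE_iff m_def)
      have "s \<iota> \<otimes> inv (s \<kappa>) = e t (\<iota> t) \<otimes> inv (e t (\<kappa> t))"
      proof -
        let ?x = "e t (\<iota> t)" and ?y = "e t (\<kappa> t)"
        have c: "?x \<in> carrier G" "?y \<in> carrier G" "?p \<in> carrier G" using e[OF t] ee rest[OF I(2)] by auto
        have "s \<iota> \<otimes> inv (s \<kappa>) = (?x \<otimes> ?p) \<otimes> (inv ?p \<otimes> inv ?y)"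
          using split[OF I(1)] split[OF I(2)] fp c by (simp add: inv_mult_group)
        also have "\<dots> = ?x \<otimes> inv ?y"
          using c by (simp add: m_assoc mult_inv_cancel)
        finally show ?thesis .
      qed
      then have "\<iota> t = \<kappa> t"
        using sep'[OF t ee, of "s \<iota>" "s \<kappa>"] C s_in I by auto
      then show "\<iota> = \<kappa>"
        using agree I by (intro PiE_ext[of _ T "\<lambda>_. {..m}"]) (auto simp: I_def)
    qed
    moreover have "?r ` B t \<subseteq> ?J" by (auto simp: B_def I_def PiE_iff extensional_def split: if_splits)
    moreover have "finite ?J" using \<open>finite T\<close> by (intro finite_PiE) auto
    ultimately have "card (B t) \<le> card ?J" by (meson card_inj_on_le)
    also have "\<dots> = Suc m ^ (m - 1)" using \<open>finite T\<close> t by (simp add: card_PiE m_def)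
    finally show ?thesis .
  qed
  \<comment> \<open>Some class must contain the identity, so \<open>T\<close> is non-empty. This
    justifies splitting \<open>Suc m ^ m\<close> as \<open>Suc m * Suc m ^ (m - 1)\<close> below,
    where the subtraction is truncated.\<close>
  have "m > 0"
    using cover one_closed \<open>finite T\<close> by (auto simp: m_def card_gt_0_iff)
  have "card I \<le> card (\<Union>t\<in>T. B t)"
    using I_sub finI \<open>finite T\<close> by (intro card_mono) (auto simp: B_def)
  also have "\<dots> \<le> (\<Sum>t\<in>T. card (B t))" using \<open>finite T\<close> by (rule card_UN_le)
  also have "\<dots> \<le> m * Suc m ^ (m - 1)"
    using sum_bounded_above[of T "\<lambda>t. card (B t)"] cardB by (simp add: m_def)
  also have "\<dots> < Suc m * Suc m ^ (m - 1)" by simp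
  also have "\<dots> = Suc m ^ m" using \<open>m > 0\<close> by (metis Suc_diff_1 power_Suc)
  also have "\<dots> = card I" using \<open>finite T\<close> by (simp add: I_def card_PiE m_def)
  finally show False by simp
qed

text \<open>Adjoining one generator multiplies the subgroup generated so far by a finite cyclic
  group, and in an abelian group such a product is again a subgroup. By contraposition, an infinite
  finitely generated lamp group has an element of infinite order.\<close>

lemma (in comm_group) finite_if_finite_exponents:
  assumes "finitely_generated_group G"
    and tors: "\<And>x. x \<in> carrier G \<Longrightarrow> \<exists>n::nat. n > 0 \<and> x [^] n = \<one>"
  shows "finite (carrier G)"
proof -
  have "finite (generate G S)" if "finite S" "S \<subseteq> carrier G" for S
    using that
  proof (induction S)
    case empty
    then show ?case by (simp add: generate_empty)
  next
    case (insert s S)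
    then have s: "s \<in> carrier G" and S: "S \<subseteq> carrier G" by auto
    obtain n where n: "n > 0" "s [^] (n::nat) = \<one>" using tors[OF s] by blast
    have sub: "subgroup (generate G {s} <#> generate G S) G"
      using s S by (intro mult_subgroups generate_is_subgroup) auto
    have cyc: "generate G {s} \<subseteq> (\<lambda>k. s [^] k) ` {..<n}"
    proof
      fix y assume "y \<in> generate G {s}"
      then obtain k :: int where "y = s [^] k" using generate_pow[OF s] by auto
      moreover have "s [^] k = s [^] nat (k mod int n)"
      proof -
        have "s [^] k = s [^] (int n * (k div int n) + k mod int n)" by simp
        also have "\<dots> = (s [^] int n) [^] (k div int n) \<otimes> s [^] (k mod int n)"
          using s by (simp only: int_pow_mult int_pow_pow)
        also have "\<dots> = s [^] (k mod int n)"
          using n s by (simp add: int_pow_int)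
        also have "\<dots> = s [^] nat (k mod int n)"
          using n by (metis int_pow_int mod_int_pos_iff nat_0_le of_nat_0_less_iff)
        finally show ?thesis .
      qed
      moreover have "nat (k mod int n) < n" using n by (simp add: nat_less_iff)
      ultimately show "y \<in> (\<lambda>k. s [^] k) ` {..<n}" by blast
    qed
    have gs: "s \<in> generate G {s}" "\<one> \<in> generate G {s}" "\<one> \<in> generate G S"
      by (auto intro: generate.incl generate.one)
    have "insert s S \<subseteq> generate G {s} <#> generate G S"
    proof -
      have "s = s \<otimes> \<one>" using s by simp
      moreover have "x = \<one> \<otimes> x" "x \<in> generate G S" if "x \<in> S" for x
        using that S by (auto intro: generate.incl)
      ultimately show ?thesis using gs unfolding set_mult_def by blast
    qed
    then have "generate G (insert s S) \<subseteq> generate G {s} <#> generate G S"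
      using sub by (rule generate_subgroup_incl)
    moreover have "finite (generate G {s} <#> generate G S)"
      unfolding set_mult_def using insert cyc finite_subset[OF cyc] S by auto
    ultimately show ?case by (rule finite_subset)
  qed
  then show ?thesis using assms(1) unfolding finitely_generated_group_def by metis
qed

section \<open>Abelian normal subgroups with torsion-free abelian quotient, and their difference
  operators\<close>

text \<open>Abstracts what the argument uses about the lamp group \<open>L\<close> of a wreath
  product. \<open>quotient_comm\<close> makes the operators t - 1 on \<open>L\<close> commute,
  \<open>no_commuting\<close> makes them injective for t outside \<open>L\<close>, and
  \<open>quotient_torsion_free\<close> keeps positive powers of such t outside
  \<open>L\<close>.\<close>

locale torsion_free_abelian_extension = normal L G for L and G (structure) +
  assumes L_comm: "\<lbrakk>f \<in> L; f' \<in> L\<rbrakk> \<Longrightarrow> f \<otimes> f' = f' \<otimes> f"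
    and quotient_comm: "\<lbrakk>g \<in> carrier G; h \<in> carrier G\<rbrakk> \<Longrightarrow> inv (h \<otimes> g) \<otimes> (g \<otimes> h) \<in> L"
    and quotient_torsion_free: "\<lbrakk>g \<in> carrier G; g [^] (k::nat) \<in> L; k > 0\<rbrakk> \<Longrightarrow> g \<in> L"
    and no_commuting: "\<lbrakk>g \<in> carrier G - L; f \<in> L; g \<otimes> f = f \<otimes> g\<rbrakk> \<Longrightarrow> f = \<one>"
begin

definition conj_by :: "'a \<Rightarrow> 'a \<Rightarrow> 'a" where
  "conj_by g f = g \<otimes> f \<otimes> inv g"

text \<open>Written additively, \<open>diff_by t\<close> is the operator \<open>t - 1\<close> on \<open>L\<close>.\<close>

definition diff_by :: "'a \<Rightarrow> 'a \<Rightarrow> 'a" where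
  "diff_by t f = inv f \<otimes> conj_by t f"

lemma L_carrier: "f \<in> L \<Longrightarrow> f \<in> carrier G"
  using subset by blast

lemma L_lcomm: "\<lbrakk>f \<in> L; f' \<in> L; h \<in> carrier G\<rbrakk> \<Longrightarrow> f \<otimes> (f' \<otimes> h) = f' \<otimes> (f \<otimes> h)"
  using L_comm L_carrier by (simp flip: m_assoc)

lemma conj_by_closed [simp]: "\<lbrakk>g \<in> carrier G; f \<in> L\<rbrakk> \<Longrightarrow> conj_by g f \<in> L"
  unfolding conj_by_def using inv_op_closed2 by blast

lemma diff_by_closed [simp]: "\<lbrakk>g \<in> carrier G; f \<in> L\<rbrakk> \<Longrightarrow> diff_by g f \<in> L"
  unfolding diff_by_def by simp

lemma conj_by_mult: "\<lbrakk>g \<in> carrier G; f \<in> carrier G; h \<in> carrier G\<rbrakk> \<Longrightarrow> conj_by g (f \<otimes> h) = conj_by g f \<otimes> conj_by g h"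
  by (simp add: conj_by_def m_assoc mult_inv_cancel)

lemma conj_by_inv: "\<lbrakk>g \<in> carrier G; f \<in> carrier G\<rbrakk> \<Longrightarrow> conj_by g (inv f) = inv (conj_by g f)"
  by (simp add: conj_by_def m_assoc inv_mult_group)

lemma conj_by_comp: "\<lbrakk>g \<in> carrier G; h \<in> carrier G; f \<in> carrier G\<rbrakk> \<Longrightarrow> conj_by (g \<otimes> h) f = conj_by g (conj_by h f)"
  by (simp add: conj_by_def m_assoc inv_mult_group)

lemma conj_by_L: "\<lbrakk>g \<in> L; f \<in> L\<rbrakk> \<Longrightarrow> conj_by g f = f"
  unfolding conj_by_def by (simp add: L_comm[of g f] m_assoc L_carrier)

text \<open>The commutator of \<open>g\<close> and \<open>h\<close> lies in the abelian group
  \<open>L\<close> and so acts trivially on it: conjugation on \<open>L\<close> factors through the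
  abelian quotient.\<close>

lemma conj_by_commute:
  assumes "g \<in> carrier G" "h \<in> carrier G" "f \<in> L"
  shows "conj_by g (conj_by h f) = conj_by h (conj_by g f)"
proof -
  let ?c = "inv (h \<otimes> g) \<otimes> (g \<otimes> h)"
  have "g \<otimes> h = (h \<otimes> g) \<otimes> ?c" using assms by (simp add: mult_inv_cancel)
  then have "conj_by (g \<otimes> h) f = conj_by ((h \<otimes> g) \<otimes> ?c) f" by simp
  also have "\<dots> = conj_by (h \<otimes> g) f"
    using assms quotient_comm by (simp add: conj_by_comp conj_by_L L_carrier)
  finally show ?thesis using assms by (simp add: conj_by_comp L_carrier)
qed

lemma diff_by_mult: "\<lbrakk>t \<in> carrier G; f \<in> L; f' \<in> L\<rbrakk> \<Longrightarrow> diff_by t (f \<otimes> f') = diff_by t f \<otimes> diff_by t f'"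
  by (simp add: diff_by_def conj_by_mult L_carrier inv_mult_group m_assoc L_comm L_lcomm)

lemma diff_by_inv: "\<lbrakk>t \<in> carrier G; f \<in> L\<rbrakk> \<Longrightarrow> diff_by t (inv f) = inv (diff_by t f)"
  by (simp add: diff_by_def conj_by_inv L_carrier inv_mult_group L_comm)

lemma diff_by_conj_by: "\<lbrakk>t \<in> carrier G; g \<in> carrier G; f \<in> L\<rbrakk> \<Longrightarrow> diff_by t (conj_by g f) = conj_by g (diff_by t f)"
  by (simp add: diff_by_def conj_by_mult conj_by_inv L_carrier conj_by_commute[of t g f])

lemma diff_by_commute: "\<lbrakk>s \<in> carrier G; t \<in> carrier G; f \<in> L\<rbrakk> \<Longrightarrow> diff_by s (diff_by t f) = diff_by t (diff_by s f)"
  by (simp add: diff_by_def[of t] diff_by_mult diff_by_inv diff_by_conj_by)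

text \<open>The operator identity gh - 1 = (g - 1) + g(h - 1).\<close>

lemma diff_by_comp:
  assumes "g \<in> carrier G" "h \<in> carrier G" "f \<in> L"
  shows "diff_by (g \<otimes> h) f = diff_by g f \<otimes> conj_by g (diff_by h f)"
proof -
  have "conj_by h f = f \<otimes> diff_by h f" using assms by (simp add: diff_by_def L_carrier mult_inv_cancel)
  then show ?thesis using assms by (simp add: diff_by_def[of g] diff_by_def[of "g \<otimes> h"] conj_by_comp conj_by_mult L_carrier m_assoc)
qed

lemma diff_by_eq_one:
  assumes "t \<in> carrier G - L" "f \<in> L" "diff_by t f = \<one>"
  shows "f = \<one>"
proof -
  have "conj_by t f = f \<otimes> diff_by t f" using assms(1,2) by (simp add: diff_by_def L_carrier mult_inv_cancel)
  then have "t \<otimes> f \<otimes> inv t = f" using assms by (simp add: conj_by_def L_carrier)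
  then have "t \<otimes> f = f \<otimes> t" using assms L_carrier by (metis DiffD1 inv_solve_right' m_closed)
  then show ?thesis using no_commuting assms by blast
qed

text \<open>If \<open>f\<close> and \<open>g\<close> both conjugate \<open>t\<close> into a subgroup
  H, then (t - 1)(f - g) lies in H. This turns information about \<open>t\<close>, which need not
  belong to \<open>L\<close>, into elements of \<open>L\<close> in H.\<close>

lemma diff_by_commutator:
  assumes "t \<in> carrier G" "f \<in> L" "g \<in> L"
  shows "diff_by t (f \<otimes> inv g) = (inv f \<otimes> t \<otimes> f) \<otimes> inv (inv g \<otimes> t \<otimes> g)"
proof -
  let ?x = "conj_by t (f \<otimes> inv g)"
  have x: "?x \<in> L" using assms by simp
  have "diff_by t (f \<otimes> inv g) = inv f \<otimes> (?x \<otimes> g)"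
    unfolding diff_by_def using assms x by (simp add: L_carrier inv_mult_group m_assoc L_comm L_lcomm)
  also have "\<dots> = (inv f \<otimes> t \<otimes> f) \<otimes> inv (inv g \<otimes> t \<otimes> g)"
    using assms by (simp add: conj_by_def L_carrier inv_mult_group m_assoc)
  finally show ?thesis .
qed

lemma comm_group_L: "comm_group (G\<lparr>carrier := L\<rparr>)"
  using subgroup_imp_group L_comm by (intro group.group_comm_groupI) (auto simp: subgroup_axioms)

text \<open>In the application \<open>H\<close> is the stabiliser of a point, and
  \<open>cover\<close> says that each point of its \<open>L\<close>-orbit is fixed by some element
  of \<open>T\<close>. The operator t - 1 sends differences within the class of \<open>t\<close>
  into \<open>H\<close>. The covering lemma, applied to the sequence of all s^i f, yields such a
  difference for every f.\<close>

lemma uniform_annihilator: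
  assumes "finite T" "T \<subseteq> carrier G - L" and H: "subgroup H G"
    and cover: "\<And>f. f \<in> L \<Longrightarrow> \<exists>t\<in>T. inv f \<otimes> t \<otimes> f \<in> H"
  shows "\<exists>t\<in>T. \<exists>s\<in>T. \<forall>f\<in>L. diff_by t (diff_by (s [^] (fact (card T) :: nat)) f) \<in> H"
proof -
  interpret LL: comm_group "G\<lparr>carrier := L\<rparr>" by (rule comm_group_L)
  have TG: "t \<in> carrier G" if "t \<in> T" for t using assms that by auto
  let ?C = "\<lambda>t. L \<inter> {f. inv f \<otimes> t \<otimes> f \<in> H}"
  have cov: "carrier (G\<lparr>carrier := L\<rparr>) \<subseteq> (\<Union>t\<in>T. {f. inv f \<otimes> t \<otimes> f \<in> H})" using cover by auto
  have "\<exists>t\<in>T. \<forall>e. (\<forall>i\<le>card T. e i \<in> L) \<longrightarrow> (\<exists>i j. i < j \<and> j \<le> card T \<and>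
      (\<exists>f\<in>?C t. \<exists>g\<in>?C t. e i \<otimes> inv\<^bsub>G\<lparr>carrier := L\<rparr>\<^esub> (e j) = f \<otimes> inv\<^bsub>G\<lparr>carrier := L\<rparr>\<^esub> g))"
    using LL.finite_cover_common_class[OF \<open>finite T\<close> cov] by simp
  then obtain t where t: "t \<in> T" and rep: "\<forall>e. (\<forall>i\<le>card T. e i \<in> L) \<longrightarrow> (\<exists>i j. i < j \<and> j \<le> card T \<and>
      (\<exists>f\<in>?C t. \<exists>g\<in>?C t. e i \<otimes> inv\<^bsub>G\<lparr>carrier := L\<rparr>\<^esub> (e j) = f \<otimes> inv\<^bsub>G\<lparr>carrier := L\<rparr>\<^esub> g))"
    by (rule bexE)
  \<comment> \<open>The cover at the identity yields an element of \<open>T\<close> that itself lies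
    in \<open>H\<close>, so conjugation by its powers preserves \<open>H\<close>.\<close>
  obtain s where s: "s \<in> T" "s \<in> H" using cover[of \<one>] TG subgroup.one_closed[OF subgroup_axioms] by auto
  have tG: "t \<in> carrier G" and sG: "s \<in> carrier G" using t s TG by auto
  have pow_H: "s [^] (k::nat) \<in> H" for k
    using s H by (induction k) (auto simp: subgroup.one_closed subgroup.m_closed)
  have conj_by_H: "conj_by (s [^] (k::nat)) f \<in> H" if "f \<in> H" for f k
    unfolding conj_by_def using that pow_H H by (simp add: subgroup.m_closed subgroup.m_inv_closed)
  have key: "diff_by t (diff_by (s [^] (fact (card T) :: nat)) f) \<in> H" if f: "f \<in> L" for f
  proof -
    have "\<forall>i\<le>card T. conj_by (s [^] i) f \<in> L" using f sG by simp
    from mp[OF spec[OF rep, of "\<lambda>i. conj_by (s [^] i) f"] this] obtain i j a b where ij: "i < j" "j \<le> card T" and ab: "a \<in> L" "b \<in> L"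
        "inv a \<otimes> t \<otimes> a \<in> H" "inv b \<otimes> t \<otimes> b \<in> H"
      and eq: "conj_by (s [^] i) f \<otimes> inv (conj_by (s [^] j) f) = a \<otimes> inv b"
      using f sG by (auto simp: m_inv_consistent subgroup_axioms)
    define k where "k = j - i"
    have k: "j = i + k" "0 < k" "k \<le> card T" using ij by (auto simp: k_def)
    \<comment> \<open>Additively, s^i f - s^(i+k) f = -s^i (s^k - 1) f.\<close>
    have "a \<otimes> inv b = conj_by (s [^] i) (inv (diff_by (s [^] k) f))"
      using f sG unfolding eq[symmetric] k(1)
      by (simp add: diff_by_def conj_by_comp conj_by_mult conj_by_inv inv_mult_group L_carrier L_comm flip: nat_pow_mult)
    moreover have "diff_by t (a \<otimes> inv b) \<in> H"
      using diff_by_commutator[OF tG ab(1,2)] ab H by (simp add: subgroup.m_closed subgroup.m_inv_closed)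
    ultimately have *: "conj_by (s [^] i) (inv (diff_by t (diff_by (s [^] k) f))) \<in> H"
      using f sG tG by (simp add: diff_by_conj_by diff_by_inv)
    let ?y = "diff_by t (diff_by (s [^] k) f)"
    have y: "?y \<in> L" using f sG tG by simp
    \<comment> \<open>The conjugation by \<open>s [^] i\<close> can be undone inside
      \<open>H\<close>, since \<open>s\<close> lies in \<open>H\<close>.\<close>
    have "inv (s [^] i) \<otimes> conj_by (s [^] i) (inv ?y) \<otimes> s [^] i = inv ?y"
      using y sG by (simp add: conj_by_def L_carrier m_assoc mult_inv_cancel)
    then have "inv ?y \<in> H"
      using * pow_H H by (metis subgroup.m_closed subgroup.m_inv_closed)
    then have yH: "?y \<in> H"
      using H y by (metis L_carrier inv_inv subgroup.m_inv_closed)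
    txt \<open>The exponent \<open>k\<close> depends on \<open>f\<close>; passing to the multiple \<open>fact (card T)\<close> removes this dependence.\<close>
    have "diff_by t (diff_by (s [^] (k * l)) f) \<in> H" for l
    proof (induction l)
      case 0
      then show ?case using f tG H by (simp add: diff_by_def conj_by_def L_carrier subgroup.one_closed)
    next
      case (Suc l)
      \<comment> \<open>Telescoping: s^(k(l+1)) - 1 = (s^(kl) - 1) + s^(kl) (s^k - 1).\<close>
      have "diff_by (s [^] (k * Suc l)) f = diff_by (s [^] (k * l)) f \<otimes> conj_by (s [^] (k * l)) (diff_by (s [^] k) f)"
        using f sG diff_by_comp[of "s [^] (k * l)" "s [^] k" f] by (simp add: nat_pow_mult add.commute)
      then have "diff_by t (diff_by (s [^] (k * Suc l)) f) = diff_by t (diff_by (s [^] (k * l)) f) \<otimes> conj_by (s [^] (k * l)) ?y"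
        using f sG tG by (simp add: diff_by_mult diff_by_conj_by)
      then show ?case using Suc conj_by_H[OF yH] H by (simp add: subgroup.m_closed)
    qed
    moreover have "k dvd (fact (card T) :: nat)" using dvd_fact[of k "card T"] k by simp
    then obtain l where "(fact (card T) :: nat) = k * l" by (rule dvdE)
    ultimately show ?thesis by simp
  qed
  then show ?thesis using t s by blast
qed

lemma diff_by_fold_closed: "\<lbrakk>set us \<subseteq> carrier G; f \<in> L\<rbrakk> \<Longrightarrow> foldr diff_by us f \<in> L"
  by (induction us) auto

lemma diff_by_fold_diff_by:
  "\<lbrakk>set us \<subseteq> carrier G; f \<in> L; t \<in> carrier G\<rbrakk> \<Longrightarrow> foldr diff_by us (diff_by t f) = diff_by t (foldr diff_by us f)"
  by (induction us) (auto simp: diff_by_fold_closed diff_by_commute)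

lemma diff_by_fold_conj_by:
  "\<lbrakk>set us \<subseteq> carrier G; f \<in> L; g \<in> carrier G\<rbrakk> \<Longrightarrow> foldr diff_by us (conj_by g f) = conj_by g (foldr diff_by us f)"
  by (induction us) (auto simp: diff_by_fold_closed diff_by_conj_by)

text \<open>The operators commute, so any factor of the product can be moved to the front.\<close>

lemma diff_by_fold_factor:
  "\<lbrakk>set us \<subseteq> carrier G; f \<in> L; u \<in> set us\<rbrakk> \<Longrightarrow> \<exists>f'\<in>L. foldr diff_by us f = diff_by u f'"
proof (induction us)
  case (Cons v us)
  show ?case
  proof (cases "u = v")
    case True
    then show ?thesis using Cons diff_by_fold_closed by auto
  next
    case False
    then obtain f' where "f' \<in> L" "foldr diff_by us f = diff_by u f'" using Cons by auto
    then show ?thesis using Cons.prems diff_by_commute[of v u f'] by (intro bexI[of _ "diff_by v f'"]) auto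
  qed
qed simp

lemma diff_by_fold_eq_one:
  "\<lbrakk>set us \<subseteq> carrier G - L; f \<in> L; foldr diff_by us f = \<one>\<rbrakk> \<Longrightarrow> f = \<one>"
proof (induction us)
  case (Cons u us)
  then have "set us \<subseteq> carrier G" by auto
  then show ?case using Cons diff_by_eq_one[of u "foldr diff_by us f"] diff_by_fold_closed[of us f] by auto
qed simp

text \<open>One product of operators, independent of the point, sends \<open>w\<close> into every
  point stabiliser. Faithfulness makes the image trivial, and injectivity of the product on
  \<open>L\<close> then makes \<open>w\<close> trivial.\<close>

lemma fixing_element_trivial:
  assumes act: "group_action G E \<phi>" and inj: "inj_on \<phi> (carrier G)"
    and T: "finite T" "T \<subseteq> carrier G - L" and w: "w \<in> L"
    and cover: "\<And>x. x \<in> E \<Longrightarrow> (\<exists>t\<in>T. \<phi> t x = x) \<or> \<phi> w x = x"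
  shows "w = \<one>"
proof -
  interpret group_action G E \<phi> by (rule act)
  obtain ts where ts: "set ts = T" using finite_list[OF T(1)] by blast
  define N :: nat where "N = fact (card T)"
  define us where "us = ts @ map (\<lambda>s. s [^] N) ts"
  have us: "set us \<subseteq> carrier G - L"
    using T quotient_torsion_free[of _ N] unfolding us_def ts[symmetric] by (auto simp: N_def)
  then have usG: "set us \<subseteq> carrier G" by auto
  txt \<open>The operators \<open>diff_by u\<close> commute, so \<open>?Q\<close> factors through whichever pair
    \<open>diff_by t\<close>, \<open>diff_by (s [^] N)\<close> annihilates the point at hand.\<close>
  let ?Q = "foldr diff_by us"
  have stabI: "inv g \<otimes> h \<otimes> g \<in> stabilizer G \<phi> x"
    if "x \<in> E" "g \<in> carrier G" "h \<in> carrier G" "\<phi> h (\<phi> g x) = \<phi> g x" for x g h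
    using that orbit_sym_aux[of g x] element_image[of g x]
    by (simp add: stabilizer_def composition_rule m_assoc)
  have Q_fix: "?Q w \<in> stabilizer G \<phi> x" if x: "x \<in> E" for x
  \<comment> \<open>Either the orbit of \<open>x\<close> contains a point whose whole
    \<open>L\<close>-orbit is fixed pointwise by elements of \<open>T\<close>, one for each point,
    or every \<open>L\<close>-orbit inside it has a point fixed by no element of \<open>T\<close>,
    which \<open>cover\<close> then hands to \<open>w\<close>.\<close>
  proof (cases "\<exists>g\<in>carrier G. \<forall>f\<in>L. \<exists>t\<in>T. \<phi> t (\<phi> f (\<phi> g x)) = \<phi> f (\<phi> g x)")
    case True
    then obtain g where g: "g \<in> carrier G"
      and fx: "\<And>f. f \<in> L \<Longrightarrow> \<exists>t\<in>T. \<phi> t (\<phi> f (\<phi> g x)) = \<phi> f (\<phi> g x)" by blast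
    define y where "y = \<phi> g x"
    have y: "y \<in> E" using element_image[OF g x] by (simp add: y_def)
    have "\<exists>t\<in>T. inv f \<otimes> t \<otimes> f \<in> stabilizer G \<phi> y" if "f \<in> L" for f
      using fx[OF that] stabI[OF y L_carrier[OF that]] T(2) unfolding y_def by blast
    from uniform_annihilator[OF T stabilizer_subgroup[OF y] this]
    obtain t s where ts': "t \<in> T" "s \<in> T" and ann: "\<And>f. f \<in> L \<Longrightarrow> diff_by t (diff_by (s [^] N) f) \<in> stabilizer G \<phi> y"
      unfolding N_def by blast
    \<comment> \<open>The annihilator is available at \<open>y\<close>, not at \<open>x\<close>.
      Applying it to \<open>conj_by g w\<close> allows conjugating back to \<open>x\<close>, because
      \<open>?Q\<close> commutes with conjugation.\<close>
    have "\<exists>f'\<in>L. ?Q (conj_by g w) = diff_by t (diff_by (s [^] N) f')"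
    proof -
      have sub: "set ts \<subseteq> carrier G" "set (map (\<lambda>s. s [^] N) ts) \<subseteq> carrier G" "s [^] N \<in> carrier G"
        using usG ts ts' T(2) by (auto simp: us_def)
      obtain f1 where f1: "f1 \<in> L" "foldr diff_by (map (\<lambda>s. s [^] N) ts) (conj_by g w) = diff_by (s [^] N) f1"
        using diff_by_fold_factor[OF sub(2), of "conj_by g w" "s [^] N"] g w ts ts' by auto
      obtain f2 where f2: "f2 \<in> L" "foldr diff_by ts f1 = diff_by t f2"
        using diff_by_fold_factor[OF sub(1) f1(1)] ts ts' by auto
      have "?Q (conj_by g w) = diff_by t (diff_by (s [^] N) f2)"
        using f1 f2 sub ts ts' diff_by_commute[of t "s [^] N" f2] by (auto simp: us_def diff_by_fold_diff_by)
      then show ?thesis using f2 by blast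
    qed
    then have "conj_by g (?Q w) \<in> stabilizer G \<phi> y"
      using ann diff_by_fold_conj_by[OF usG w g] by auto
    then have "inv g \<otimes> conj_by g (?Q w) \<otimes> g \<in> stabilizer G \<phi> x"
      using stabI[OF x g, of "conj_by g (?Q w)"] by (simp add: stabilizer_def y_def)
    moreover have "?Q w \<in> carrier G" using diff_by_fold_closed[OF usG w] L_carrier by blast
    ultimately show ?thesis using g by (simp add: conj_by_def m_assoc mult_inv_cancel)
  next
    case False
    have St: "subgroup (stabilizer G \<phi> x) G" by (rule stabilizer_subgroup[OF x])
    have w_fix: "conj_by h w \<in> stabilizer G \<phi> x" if h: "h \<in> carrier G" for h
    proof -
      let ?g = "inv h"
      have g: "?g \<in> carrier G" using h by simp
      then have gx: "\<phi> ?g x \<in> E" using element_image x by blast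
      obtain f where f: "f \<in> L" "\<not> (\<exists>t\<in>T. \<phi> t (\<phi> f (\<phi> ?g x)) = \<phi> f (\<phi> ?g x))" using False g by blast
      then have "\<phi> w (\<phi> f (\<phi> ?g x)) = \<phi> f (\<phi> ?g x)"
        using cover[of "\<phi> f (\<phi> ?g x)"] element_image[OF L_carrier[OF f(1)] gx] by blast
      then have "inv f \<otimes> w \<otimes> f \<in> stabilizer G \<phi> (\<phi> ?g x)"
        using stabI[OF gx] f(1) w L_carrier by blast
      \<comment> \<open>Because \<open>w\<close> commutes with \<open>f\<close>, fixing one point of
        an \<open>L\<close>-orbit means fixing the point it started from.\<close>
      moreover have "inv f \<otimes> w \<otimes> f = w"
        using f(1) w by (simp add: L_carrier m_assoc L_comm[of w f] mult_inv_cancel)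
      ultimately have "\<phi> w (\<phi> ?g x) = \<phi> ?g x" by (simp add: stabilizer_def)
      then show ?thesis using stabI[OF x g] w L_carrier h by (simp add: conj_by_def)
    qed
    \<comment> \<open>The induction must carry all conjugates: a conjugate of (v - 1)f is a quotient
      of two conjugates of f, so this set is closed under each \<open>diff_by v\<close>.\<close>
    have "foldr diff_by vs w \<in> {f \<in> L. \<forall>g\<in>carrier G. conj_by g f \<in> stabilizer G \<phi> x}"
      if "set vs \<subseteq> carrier G" for vs
      using that
    proof (induction vs)
      case Nil
      then show ?case using w w_fix by simp
    next
      case (Cons v vs)
      then have f: "foldr diff_by vs w \<in> L" and fx: "\<And>g. g \<in> carrier G \<Longrightarrow> conj_by g (foldr diff_by vs w) \<in> stabilizer G \<phi> x"
        and v: "v \<in> carrier G" by auto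
      have "conj_by g (diff_by v (foldr diff_by vs w)) \<in> stabilizer G \<phi> x" if g: "g \<in> carrier G" for g
      proof -
        have "conj_by g (diff_by v (foldr diff_by vs w)) = inv (conj_by g (foldr diff_by vs w)) \<otimes> conj_by (g \<otimes> v) (foldr diff_by vs w)"
          using f g v by (simp add: diff_by_def conj_by_mult conj_by_inv conj_by_comp L_carrier)
        then show ?thesis
          using fx[OF g] fx[of "g \<otimes> v"] g v St by (simp add: subgroup.m_closed subgroup.m_inv_closed)
      qed
      then show ?case using f v by simp
    qed
    from this[OF usG] have "conj_by \<one> (?Q w) \<in> stabilizer G \<phi> x" and "?Q w \<in> L" by auto
    then show ?thesis by (simp add: conj_by_def L_carrier)
  qed
  have QG: "?Q w \<in> carrier G" using diff_by_fold_closed[OF usG w] L_carrier by blast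
  have "\<phi> (?Q w) = \<phi> \<one>"
  proof (rule extensionalityI)
    show "\<phi> (?Q w) \<in> extensional E" "\<phi> \<one> \<in> extensional E"
      using bij_prop0[OF QG] bij_prop0[of \<one>] by (auto intro: Bij_imp_extensional)
    show "\<phi> (?Q w) x = \<phi> \<one> x" if "x \<in> E" for x
      using Q_fix[OF that] that by (simp add: stabilizer_def flip: id_eq_one)
  qed
  then have "?Q w = \<one>" using inj QG by (auto dest: inj_onD)
  then show ?thesis using diff_by_fold_eq_one[OF us w] by simp
qed

end

text \<open>Takes for \<open>T\<close> the finitely many words outside \<open>L\<close>. Points
  whose recurrent word falls inside \<open>L\<close> are left to \<open>w\<close> through
  \<open>exceptional\<close>.\<close>

lemma (in torsion_free_abelian_extension) recurrent_element_trivial: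
  fixes n :: nat
  assumes act: "group_action G E \<phi>" "inj_on \<phi> (carrier G)"
    and pq: "p \<in> carrier G" "q \<in> carrier G" and w: "w \<in> L"
    and recur: "\<And>x. x \<in> E \<Longrightarrow> \<exists>i<n. \<exists>j<n. \<exists>k<n. \<exists>l<n. (i, j) \<noteq> (k, l) \<and>
           \<phi> (inv (p [^] i \<otimes> q [^] j) \<otimes> (p [^] k \<otimes> q [^] l)) x = x"
    and exceptional: "\<And>i j k l x. \<lbrakk>i < n; j < n; k < n; l < n; (i, j) \<noteq> (k, l); x \<in> E;
           inv (p [^] i \<otimes> q [^] j) \<otimes> (p [^] k \<otimes> q [^] l) \<in> L;
           \<phi> (inv (p [^] i \<otimes> q [^] j) \<otimes> (p [^] k \<otimes> q [^] l)) x = x\<rbrakk> \<Longrightarrow> \<phi> w x = x"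
  shows "w = \<one>"
proof (rule fixing_element_trivial[OF act _ _ w])
  let ?t = "\<lambda>(i, j, k, l). inv (p [^] i \<otimes> q [^] j) \<otimes> (p [^] k \<otimes> q [^] l)"
  let ?T = "?t ` ({..<n} \<times> {..<n} \<times> {..<n} \<times> {..<n}) - L"
  show "finite ?T" by auto
  show "?T \<subseteq> carrier G - L" using pq by auto
  show "(\<exists>t\<in>?T. \<phi> t x = x) \<or> \<phi> w x = x" if x: "x \<in> E" for x
  proof -
    obtain i j k l where *: "i < n" "j < n" "k < n" "l < n" "(i, j) \<noteq> (k, l)" "\<phi> (?t (i, j, k, l)) x = x"
      using recur[OF x] by auto
    show ?thesis
    proof (cases "?t (i, j, k, l) \<in> L")
      case True
      then show ?thesis using exceptional[OF *(1-5) x] * by simp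
    next
      case False
      have "?t (i, j, k, l) \<in> ?t ` ({..<n} \<times> {..<n} \<times> {..<n} \<times> {..<n})"
        using * by (intro imageI) auto
      then show ?thesis using False *(6) by blast
    qed
  qed
qed

section \<open>Linear growth of orbits in the topological full group\<close>

text \<open>By compactness, finitely many of the neighbourhoods on which \<open>h\<close> is a
  single power of the generator cover the space.\<close>

lemma full_group_bounded_displacement:
  assumes comp: "compact_space T"
    and h: "h \<in> carrier (topological_full_group integer_group T \<alpha>)"
  shows "\<exists>C::int. \<forall>x\<in>topspace T. \<exists>k. \<bar>k\<bar> \<le> C \<and> h x = \<alpha> k x"
proof -
  obtain U k where U: "\<And>x. x \<in> topspace T \<Longrightarrow> openin T (U x) \<and> x \<in> U x \<and> (\<forall>y\<in>U x. h y = \<alpha> (k x) y)"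
    using h unfolding topological_full_group_def by simp metis
  have "\<forall>V\<in>U ` topspace T. openin T V" "topspace T \<subseteq> \<Union>(U ` topspace T)" using U by auto
  then obtain F where F: "finite F" "F \<subseteq> U ` topspace T" "topspace T \<subseteq> \<Union>F"
    using comp unfolding compact_space_alt by meson
  then obtain D where D: "finite D" "D \<subseteq> topspace T" "F = U ` D" by (meson finite_subset_image)
  \<comment> \<open>The sum serves as a common bound that is also defined for empty
    \<open>D\<close>.\<close>
  have "\<exists>j. \<bar>j\<bar> \<le> (\<Sum>d\<in>D. \<bar>k d\<bar>) \<and> h x = \<alpha> j x" if x: "x \<in> topspace T" for x
  proof -
    obtain d where d: "d \<in> D" "x \<in> U d" using F(3) D(3) x by auto
    then have "h x = \<alpha> (k d) x" using U D by auto
    moreover have "\<bar>k d\<bar> \<le> (\<Sum>d\<in>D. \<bar>k d\<bar>)" using d D by (intro member_le_sum) auto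
    ultimately show ?thesis by blast
  qed
  then show ?thesis by blast
qed

lemma (in group_action) bounded_displacement_pow:
  assumes act: "group_action integer_group E \<alpha>" and p: "p \<in> carrier G"
    and C: "\<And>x. x \<in> E \<Longrightarrow> \<exists>k. \<bar>k\<bar> \<le> C \<and> \<phi> p x = \<alpha> k x"
    and x: "x \<in> E"
  shows "\<exists>k. \<bar>k\<bar> \<le> C * int i \<and> \<phi> (p [^] i) x = \<alpha> k x"
  using x
proof (induction i arbitrary: x)
  case 0
  interpret Z: group_action integer_group E \<alpha> by (rule act)
  show ?case using 0 id_eq_one Z.id_eq_one by (auto simp: nat_pow_def)
next
  case (Suc i)
  interpret Z: group_action integer_group E \<alpha> by (rule act)
  interpret G: group G using group_hom group_hom.axioms(1) by auto
  obtain k where k: "\<bar>k\<bar> \<le> C" "\<phi> p x = \<alpha> k x" using C[OF Suc.prems] by blast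
  have px: "\<phi> p x \<in> E" using element_image[OF p Suc.prems] by blast
  obtain l where l: "\<bar>l\<bar> \<le> C * int i" "\<phi> (p [^] i) (\<phi> p x) = \<alpha> l (\<phi> p x)" using Suc.IH[OF px] by blast
  have "\<phi> (p [^] Suc i) x = \<alpha> (l + k) x"
    using k l Suc.prems p Z.composition_rule[of x l k] by (simp add: composition_rule)
  moreover have "\<bar>l + k\<bar> \<le> C * int (Suc i)" using k l by (simp add: algebra_simps)
  ultimately show ?case by blast
qed

text \<open>The n^2 products p^i q^j shift \<open>x\<close> along its Z-orbit by amounts from a
  range of size linear in n, so two of them agree at \<open>x\<close>. The bound \<open>n\<close>
  does not depend on \<open>x\<close>, which is what makes the resulting set of words
  finite.\<close>

lemma (in group_action) linear_growth_recurrence: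
  assumes act: "group_action integer_group E \<alpha>" and pq: "p \<in> carrier G" "q \<in> carrier G"
    and p: "\<exists>C. \<forall>x\<in>E. \<exists>k. \<bar>k\<bar> \<le> C \<and> \<phi> p x = \<alpha> k x"
    and q: "\<exists>C. \<forall>x\<in>E. \<exists>k. \<bar>k\<bar> \<le> C \<and> \<phi> q x = \<alpha> k x"
  shows "\<exists>n::nat. \<forall>x\<in>E. \<exists>i<n. \<exists>j<n. \<exists>k<n. \<exists>l<n. (i, j) \<noteq> (k, l) \<and>
           \<phi> (inv (p [^] i \<otimes> q [^] j) \<otimes> (p [^] k \<otimes> q [^] l)) x = x"
proof -
  interpret Z: group_action integer_group E \<alpha> by (rule act)
  interpret G: group G using group_hom group_hom.axioms(1) by auto
  obtain Cp Cq where Cp: "\<And>x. x \<in> E \<Longrightarrow> \<exists>k. \<bar>k\<bar> \<le> Cp \<and> \<phi> p x = \<alpha> k x"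
    and Cq: "\<And>x. x \<in> E \<Longrightarrow> \<exists>k. \<bar>k\<bar> \<le> Cq \<and> \<phi> q x = \<alpha> k x" using p q by blast
  define C where "C = nat (max \<bar>Cp\<bar> \<bar>Cq\<bar>)"
  \<comment> \<open>Chosen so that n^2 = 4Cn + 2n exceeds 4Cn + 1, the number of integers of
    absolute value at most 2Cn.\<close>
  define n where "n = 4 * C + 2"
  have "\<exists>i<n. \<exists>j<n. \<exists>k<n. \<exists>l<n. (i, j) \<noteq> (k, l) \<and>
           \<phi> (inv (p [^] i \<otimes> q [^] j) \<otimes> (p [^] k \<otimes> q [^] l)) x = x" if x: "x \<in> E" for x
  proof -
    let ?g = "\<lambda>(i, j). p [^] i \<otimes> q [^] j"
    let ?S = "{..<n} \<times> {..<n}"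
    let ?R = "{- int (2 * C * n) .. int (2 * C * n)}"
    have "\<exists>m. m \<in> ?R \<and> \<phi> (?g s) x = \<alpha> m x" if s: "s \<in> ?S" for s
    proof -
      obtain i j where ij: "s = (i, j)" "i < n" "j < n" using s by auto
      obtain l where l: "\<bar>l\<bar> \<le> Cq * int j" "\<phi> (q [^] j) x = \<alpha> l x"
        using bounded_displacement_pow[OF act pq(2) Cq x] by blast
      have qx: "\<phi> (q [^] j) x \<in> E" using element_image[of "q [^] j" x] pq x by simp
      obtain k where k: "\<bar>k\<bar> \<le> Cp * int i" "\<phi> (p [^] i) (\<phi> (q [^] j) x) = \<alpha> k (\<phi> (q [^] j) x)"
        using bounded_displacement_pow[OF act pq(1) Cp qx] by blast
      have "\<phi> (?g s) x = \<alpha> (k + l) x"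
        using k l x pq ij Z.composition_rule[of x k l] by (simp add: composition_rule)
      moreover have "Cq * int j \<le> int C * int n"
        using ij by (intro mult_mono) (auto simp: C_def)
      moreover have "Cp * int i \<le> int C * int n"
        using ij by (intro mult_mono) (auto simp: C_def)
      ultimately show ?thesis using k l by (intro exI[of _ "k + l"]) auto
    qed
    then obtain f where f: "\<And>s. s \<in> ?S \<Longrightarrow> f s \<in> ?R \<and> \<phi> (?g s) x = \<alpha> (f s) x" by metis
    have "\<not> inj_on f ?S"
    proof
      assume "inj_on f ?S"
      then have "card ?S \<le> card ?R" using f by (intro card_inj_on_le[of f]) auto
      moreover have "card ?R = 4 * C * n + 1" by (simp add: nat_eq_iff)
      ultimately have "n * n \<le> 4 * C * n + 1" by simp
      moreover have "4 * C * n + 1 < n * n"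
        unfolding n_def by (simp add: algebra_simps)
      ultimately show False by simp
    qed
    then obtain s t where st: "s \<in> ?S" "t \<in> ?S" "s \<noteq> t" "f s = f t" unfolding inj_on_def by blast
    obtain i j k l where ij: "s = (i, j)" "t = (k, l)" by fastforce
    have eq: "\<phi> (?g t) x = \<phi> (?g s) x" using f st by metis
    have gs: "?g s \<in> carrier G" "?g t \<in> carrier G" using pq ij by auto
    have "\<phi> (inv (?g s) \<otimes> ?g t) x = x"
      using gs x eq orbit_sym_aux[OF gs(1) x refl] by (simp add: composition_rule)
    then show ?thesis using st ij by auto
  qed
  then show ?thesis by blast
qed

section \<open>Wreath products as extensions of a torsion-free abelian group by the lamps\<close>

lemma group_semidirect_product:
  assumes "group N" "group H"
    and hom: "\<And>h. h \<in> carrier H \<Longrightarrow> \<alpha> h \<in> hom N N"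
    and comp: "\<And>h k x. \<lbrakk>h \<in> carrier H; k \<in> carrier H; x \<in> carrier N\<rbrakk> \<Longrightarrow> \<alpha> (h \<otimes>\<^bsub>H\<^esub> k) x = \<alpha> h (\<alpha> k x)"
    and one: "\<And>x. x \<in> carrier N \<Longrightarrow> \<alpha> \<one>\<^bsub>H\<^esub> x = x"
  shows "group (semidirect_product N H \<alpha>)"
proof -
  interpret N: group N by fact
  interpret H: group H by fact
  have closed: "\<alpha> h x \<in> carrier N" if "h \<in> carrier H" "x \<in> carrier N" for h x
    using hom[OF that(1)] that(2) by (rule hom_in_carrier)
  have mult: "\<alpha> h (x \<otimes>\<^bsub>N\<^esub> y) = \<alpha> h x \<otimes>\<^bsub>N\<^esub> \<alpha> h y"
    if "h \<in> carrier H" "x \<in> carrier N" "y \<in> carrier N" for h x y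
    using hom[OF that(1)] that(2,3) by (rule hom_mult)
  show ?thesis
  proof (rule groupI)
    fix z assume "z \<in> carrier (semidirect_product N H \<alpha>)"
    then obtain x h where z: "z = (x, h)" "x \<in> carrier N" "h \<in> carrier H"
      by (auto simp: semidirect_product_def)
    let ?y = "(\<alpha> (inv\<^bsub>H\<^esub> h) (inv\<^bsub>N\<^esub> x), inv\<^bsub>H\<^esub> h)"
    have "\<alpha> (inv\<^bsub>H\<^esub> h) (inv\<^bsub>N\<^esub> x) \<otimes>\<^bsub>N\<^esub> \<alpha> (inv\<^bsub>H\<^esub> h) x = \<alpha> (inv\<^bsub>H\<^esub> h) \<one>\<^bsub>N\<^esub>"
      using z by (simp flip: mult)
    also have "\<dots> = \<one>\<^bsub>N\<^esub>" using z hom_one[OF hom] N.is_group by simp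
    finally show "\<exists>y\<in>carrier (semidirect_product N H \<alpha>).
        y \<otimes>\<^bsub>semidirect_product N H \<alpha>\<^esub> z = \<one>\<^bsub>semidirect_product N H \<alpha>\<^esub>"
      using z closed by (intro bexI[of _ ?y]) (auto simp: semidirect_product_def)
  qed (auto simp: semidirect_product_def closed mult comp one N.m_assoc H.m_assoc)
qed

definition lamp :: "('a, 'm) monoid_scheme \<Rightarrow> ('b, 'n) monoid_scheme \<Rightarrow> 'a \<Rightarrow> ('b \<Rightarrow> 'a) \<times> 'b" where
  "lamp A B a = (\<lambda>b\<in>carrier B. if b = \<one>\<^bsub>B\<^esub> then a else \<one>\<^bsub>A\<^esub>, \<one>\<^bsub>B\<^esub>)"

text \<open>The canonical copy of \<open>B\<close>, complementary to the lamps. What is often called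
  the base group of a wreath product is the kernel of \<open>snd\<close> here.\<close>

definition base :: "('a, 'm) monoid_scheme \<Rightarrow> ('b, 'n) monoid_scheme \<Rightarrow> 'b \<Rightarrow> ('b \<Rightarrow> 'a) \<times> 'b" where
  "base A B b = (\<lambda>c\<in>carrier B. \<one>\<^bsub>A\<^esub>, b)"

context
  fixes A :: "('a, 'm) monoid_scheme" and B :: "('b, 'n) monoid_scheme"
  assumes A: "comm_group A" and B: "comm_group B"
    and torsion_free: "\<forall>b\<in>carrier B. \<forall>k::nat. b [^]\<^bsub>B\<^esub> k = \<one>\<^bsub>B\<^esub> \<longrightarrow> k > 0 \<longrightarrow> b = \<one>\<^bsub>B\<^esub>"
begin

interpretation A: comm_group A by (rule A)
interpretation B: comm_group B by (rule B)

lemma carrier_lamps: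
  "carrier (sum_group (carrier B) (\<lambda>_. A)) = {x \<in> carrier B \<rightarrow>\<^sub>E carrier A. finite {b \<in> carrier B. x b \<noteq> \<one>\<^bsub>A\<^esub>}}"
  by (simp add: carrier_sum_group A.is_group)

text \<open>The support of the shifted function is the translate by \<open>b\<close> of the old
  support, hence still finite.\<close>

lemma shift_hom:
  assumes b: "b \<in> carrier B"
  shows "(\<lambda>x. \<lambda>c\<in>carrier B. x (inv\<^bsub>B\<^esub> b \<otimes>\<^bsub>B\<^esub> c)) \<in> hom (sum_group (carrier B) (\<lambda>_. A)) (sum_group (carrier B) (\<lambda>_. A))"
proof (rule homI)
  fix x assume x: "x \<in> carrier (sum_group (carrier B) (\<lambda>_. A))"
  have "{c \<in> carrier B. x (inv\<^bsub>B\<^esub> b \<otimes>\<^bsub>B\<^esub> c) \<noteq> \<one>\<^bsub>A\<^esub>} \<subseteq> (\<lambda>c. b \<otimes>\<^bsub>B\<^esub> c) ` {c \<in> carrier B. x c \<noteq> \<one>\<^bsub>A\<^esub>}"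
  proof
    fix c assume "c \<in> {c \<in> carrier B. x (inv\<^bsub>B\<^esub> b \<otimes>\<^bsub>B\<^esub> c) \<noteq> \<one>\<^bsub>A\<^esub>}"
    then show "c \<in> (\<lambda>c. b \<otimes>\<^bsub>B\<^esub> c) ` {c \<in> carrier B. x c \<noteq> \<one>\<^bsub>A\<^esub>}"
      using b by (intro image_eqI[of _ _ "inv\<^bsub>B\<^esub> b \<otimes>\<^bsub>B\<^esub> c"]) (auto simp: B.mult_inv_cancel)
  qed
  then have "finite {c \<in> carrier B. x (inv\<^bsub>B\<^esub> b \<otimes>\<^bsub>B\<^esub> c) \<noteq> \<one>\<^bsub>A\<^esub>}"
    using x by (auto simp: carrier_lamps intro: finite_subset)
  moreover have "{c \<in> carrier B. (\<lambda>c\<in>carrier B. x (inv\<^bsub>B\<^esub> b \<otimes>\<^bsub>B\<^esub> c)) c \<noteq> \<one>\<^bsub>A\<^esub>}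
      = {c \<in> carrier B. x (inv\<^bsub>B\<^esub> b \<otimes>\<^bsub>B\<^esub> c) \<noteq> \<one>\<^bsub>A\<^esub>}" by auto
  ultimately show "(\<lambda>c\<in>carrier B. x (inv\<^bsub>B\<^esub> b \<otimes>\<^bsub>B\<^esub> c)) \<in> carrier (sum_group (carrier B) (\<lambda>_. A))"
    using x b unfolding carrier_lamps by auto
qed (use b in \<open>auto intro!: restrict_ext\<close>)

lemma group_wreath_product: "group (wreath_product A B)"
  unfolding wreath_product_def
proof (rule group_semidirect_product)
  show "(\<lambda>c\<in>carrier B. x (inv\<^bsub>B\<^esub> \<one>\<^bsub>B\<^esub> \<otimes>\<^bsub>B\<^esub> c)) = x"
    if "x \<in> carrier (sum_group (carrier B) (\<lambda>_. A))" for x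
  proof (rule extensionalityI[of _ "carrier B"])
    show "x \<in> extensional (carrier B)" using that by (auto simp: carrier_lamps PiE_def)
  qed auto
qed (auto simp: A.is_group B.is_group shift_hom B.inv_mult_group B.m_assoc intro!: restrict_ext)

lemma wreath_mult:
  "(x, b) \<otimes>\<^bsub>wreath_product A B\<^esub> (y, c) =
     (\<lambda>e\<in>carrier B. x e \<otimes>\<^bsub>A\<^esub> (\<lambda>c\<in>carrier B. y (inv\<^bsub>B\<^esub> b \<otimes>\<^bsub>B\<^esub> c)) e, b \<otimes>\<^bsub>B\<^esub> c)"
  by (simp add: wreath_product_def semidirect_product_def)

lemma carrier_wreath: "carrier (wreath_product A B) = carrier (sum_group (carrier B) (\<lambda>_. A)) \<times> carrier B"
  by (simp add: wreath_product_def semidirect_product_def)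

lemma one_wreath: "\<one>\<^bsub>wreath_product A B\<^esub> = (\<lambda>c\<in>carrier B. \<one>\<^bsub>A\<^esub>, \<one>\<^bsub>B\<^esub>)"
  by (simp add: wreath_product_def semidirect_product_def)

lemma snd_hom: "snd \<in> hom (wreath_product A B) B"
  by (rule homI) (auto simp: carrier_wreath wreath_mult)

text \<open>A non-trivial value at c would recur at all b^n c. These points are distinct because
  \<open>b\<close> has infinite order, contradicting finite support.\<close>

lemma shift_invariant_lamp:
  assumes x: "x \<in> carrier (sum_group (carrier B) (\<lambda>_. A))" and b: "b \<in> carrier B" "b \<noteq> \<one>\<^bsub>B\<^esub>"
    and shift: "\<And>c. c \<in> carrier B \<Longrightarrow> x (inv\<^bsub>B\<^esub> b \<otimes>\<^bsub>B\<^esub> c) = x c"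
  shows "x = (\<lambda>c\<in>carrier B. \<one>\<^bsub>A\<^esub>)"
proof (rule ccontr)
  assume "x \<noteq> (\<lambda>c\<in>carrier B. \<one>\<^bsub>A\<^esub>)"
  moreover have "x \<in> extensional (carrier B)" using x by (auto simp: carrier_lamps PiE_def)
  ultimately obtain c where c: "c \<in> carrier B" "x c \<noteq> \<one>\<^bsub>A\<^esub>"
    using extensionalityI[of x "carrier B" "\<lambda>c\<in>carrier B. \<one>\<^bsub>A\<^esub>"] by auto
  have "x (b [^]\<^bsub>B\<^esub> n \<otimes>\<^bsub>B\<^esub> c) = x c" for n :: nat
  proof (induction n)
    case (Suc n)
    have "inv\<^bsub>B\<^esub> b \<otimes>\<^bsub>B\<^esub> (b [^]\<^bsub>B\<^esub> Suc n \<otimes>\<^bsub>B\<^esub> c) = b [^]\<^bsub>B\<^esub> n \<otimes>\<^bsub>B\<^esub> c"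
      using b c unfolding B.nat_pow_Suc2[OF b(1)] by (simp add: B.m_assoc B.mult_inv_cancel)
    then show ?case using shift[of "b [^]\<^bsub>B\<^esub> Suc n \<otimes>\<^bsub>B\<^esub> c"] Suc b c by (simp del: B.nat_pow_Suc)
  qed (use c in simp)
  then have "range (\<lambda>n::nat. b [^]\<^bsub>B\<^esub> n \<otimes>\<^bsub>B\<^esub> c) \<subseteq> {c \<in> carrier B. x c \<noteq> \<one>\<^bsub>A\<^esub>}"
    using b c by auto
  then have "finite (range (\<lambda>n::nat. b [^]\<^bsub>B\<^esub> n \<otimes>\<^bsub>B\<^esub> c))"
    using x by (auto simp: carrier_lamps intro: finite_subset)
  then have "\<not> inj (\<lambda>n::nat. b [^]\<^bsub>B\<^esub> n \<otimes>\<^bsub>B\<^esub> c)"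
    using finite_imageD infinite_UNIV_nat by blast
  then obtain m n :: nat where "m < n" "b [^]\<^bsub>B\<^esub> m \<otimes>\<^bsub>B\<^esub> c = b [^]\<^bsub>B\<^esub> n \<otimes>\<^bsub>B\<^esub> c"
    unfolding inj_def by (metis linorder_neqE_nat)
  then have mn: "m < n" "b [^]\<^bsub>B\<^esub> n = b [^]\<^bsub>B\<^esub> m" using b c by auto
  have "b [^]\<^bsub>B\<^esub> (n - m) = \<one>\<^bsub>B\<^esub>"
    using B.pow_eq_div2[OF b(1) mn(2)] by simp
  from torsion_free[rule_format, OF b(1) this] show False using mn(1) b(2) by simp
qed

lemma torsion_free_abelian_extension_wreath:
  "torsion_free_abelian_extension (kernel (wreath_product A B) B snd) (wreath_product A B)"
proof -
  let ?W = "wreath_product A B"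
  interpret W: group ?W by (rule group_wreath_product)
  interpret h: group_hom ?W B snd by unfold_locales (rule snd_hom)
  interpret normal "kernel ?W B snd" ?W by (rule h.normal_kernel)
  have ker: "kernel ?W B snd = carrier (sum_group (carrier B) (\<lambda>_. A)) \<times> {\<one>\<^bsub>B\<^esub>}"
    by (auto simp: kernel_def carrier_wreath)
  show ?thesis
  proof unfold_locales
    show "f \<otimes>\<^bsub>?W\<^esub> g = g \<otimes>\<^bsub>?W\<^esub> f" if "f \<in> kernel ?W B snd" "g \<in> kernel ?W B snd" for f g
      using that by (auto simp: ker wreath_mult carrier_lamps PiE_iff A.m_comm intro!: restrict_ext)
    show "inv\<^bsub>?W\<^esub> (h \<otimes>\<^bsub>?W\<^esub> g) \<otimes>\<^bsub>?W\<^esub> (g \<otimes>\<^bsub>?W\<^esub> h) \<in> kernel ?W B snd"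
      if gh: "g \<in> carrier ?W" "h \<in> carrier ?W" for g h
    proof -
      have c: "snd g \<in> carrier B" "snd h \<in> carrier B" using gh by auto
      have "snd (inv\<^bsub>?W\<^esub> (h \<otimes>\<^bsub>?W\<^esub> g) \<otimes>\<^bsub>?W\<^esub> (g \<otimes>\<^bsub>?W\<^esub> h))
          = inv\<^bsub>B\<^esub> snd (h \<otimes>\<^bsub>?W\<^esub> g) \<otimes>\<^bsub>B\<^esub> snd (g \<otimes>\<^bsub>?W\<^esub> h)"
        using gh h.hom_mult h.hom_inv by (metis W.inv_closed W.m_closed)
      also have "snd (h \<otimes>\<^bsub>?W\<^esub> g) = snd (g \<otimes>\<^bsub>?W\<^esub> h)"
        using gh c by (metis h.hom_mult B.m_comm)
      also have "inv\<^bsub>B\<^esub> snd (g \<otimes>\<^bsub>?W\<^esub> h) \<otimes>\<^bsub>B\<^esub> snd (g \<otimes>\<^bsub>?W\<^esub> h) = \<one>\<^bsub>B\<^esub>"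
        using gh by (metis B.l_inv W.m_closed h.hom_closed)
      finally show ?thesis using gh by (simp only: kernel_def mem_Collect_eq W.m_closed W.inv_closed)
    qed
    show "g \<in> kernel ?W B snd" if g: "g \<in> carrier ?W" "g [^]\<^bsub>?W\<^esub> k \<in> kernel ?W B snd" "k > 0" for g and k :: nat
    proof -
      have "snd g [^]\<^bsub>B\<^esub> k = \<one>\<^bsub>B\<^esub>" using g(2) h.hom_nat_pow[OF g(1), of k] by (simp only: kernel_def mem_Collect_eq)
      then have "snd g = \<one>\<^bsub>B\<^esub>" using torsion_free[rule_format, OF h.hom_closed[OF g(1)] _ g(3)] by blast
      then show ?thesis using g(1) by (simp only: kernel_def mem_Collect_eq)
    qed
    show "f = \<one>\<^bsub>?W\<^esub>" if g: "g \<in> carrier ?W - kernel ?W B snd" and f: "f \<in> kernel ?W B snd"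
      and comm: "g \<otimes>\<^bsub>?W\<^esub> f = f \<otimes>\<^bsub>?W\<^esub> g" for f g
    proof -
      obtain y b where y: "g = (y, b)" "y \<in> carrier (sum_group (carrier B) (\<lambda>_. A))" "b \<in> carrier B" "b \<noteq> \<one>\<^bsub>B\<^esub>"
        using g by (cases g) (auto simp: carrier_wreath kernel_def)
      obtain x where x: "f = (x, \<one>\<^bsub>B\<^esub>)" "x \<in> carrier (sum_group (carrier B) (\<lambda>_. A))"
        using f unfolding ker by auto
      have "x (inv\<^bsub>B\<^esub> b \<otimes>\<^bsub>B\<^esub> c) = x c" if c: "c \<in> carrier B" for c
      proof -
        \<comment> \<open>Evaluates both sides of \<open>comm\<close> at \<open>c\<close>;
          cancelling \<open>y c\<close> in the abelian group \<open>A\<close> leaves invariance of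
          \<open>x\<close> under the shift by \<open>b\<close>.\<close>
        have "y c \<otimes>\<^bsub>A\<^esub> x (inv\<^bsub>B\<^esub> b \<otimes>\<^bsub>B\<^esub> c) = x c \<otimes>\<^bsub>A\<^esub> y c"
        proof -
          have "fst (g \<otimes>\<^bsub>?W\<^esub> f) c = fst (f \<otimes>\<^bsub>?W\<^esub> g) c" by (simp only: comm)
          then show ?thesis using c by (simp add: x y wreath_mult)
        qed
        moreover have "y c \<in> carrier A" "x c \<in> carrier A" "x (inv\<^bsub>B\<^esub> b \<otimes>\<^bsub>B\<^esub> c) \<in> carrier A"
          using x(2) y(2,3) c by (auto simp: carrier_lamps PiE_iff)
        ultimately show ?thesis by (simp add: A.m_comm[of "x c"])
      qed
      from shift_invariant_lamp[OF x(2) y(3,4) this] show ?thesis by (simp add: x one_wreath)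
    qed
  qed
qed

lemma base_closed: "b \<in> carrier B \<Longrightarrow> base A B b \<in> carrier (wreath_product A B)"
  by (auto simp: base_def carrier_wreath carrier_lamps)

lemma lamp_hom: "lamp A B \<in> hom A (wreath_product A B)"
proof (rule homI)
  fix a assume a: "a \<in> carrier A"
  have "{b \<in> carrier B. (\<lambda>b\<in>carrier B. if b = \<one>\<^bsub>B\<^esub> then a else \<one>\<^bsub>A\<^esub>) b \<noteq> \<one>\<^bsub>A\<^esub>} \<subseteq> {\<one>\<^bsub>B\<^esub>}"
    by auto
  then show "lamp A B a \<in> carrier (wreath_product A B)"
    using a finite_subset by (fastforce simp: lamp_def carrier_wreath carrier_lamps)
qed (auto simp: lamp_def wreath_mult intro!: restrict_ext)

end

lemma lamp_eq_one: "lamp A B a = \<one>\<^bsub>wreath_product A B\<^esub> \<Longrightarrow> \<one>\<^bsub>B\<^esub> \<in> carrier B \<Longrightarrow> a = \<one>\<^bsub>A\<^esub>"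
  by (auto simp: lamp_def wreath_product_def semidirect_product_def fun_eq_iff split: if_splits)

section \<open>Recurrent words and the coordinates of the free abelian group\<close>

text \<open>With equal powers of \<open>p\<close> the word collapses to q^(l-j), whose exponent is
  non-zero, at most \<open>n\<close> in absolute value, and therefore divides n!. One power of
  \<open>q\<close> thus serves all such words.\<close>

lemma (in group) fact_pow_mem_subgroup:
  assumes pq: "p \<in> carrier G" "q \<in> carrier G" and H: "subgroup H G"
    and mem: "inv (p [^] (i::nat) \<otimes> q [^] j) \<otimes> (p [^] i \<otimes> q [^] l) \<in> H"
    and jl: "j \<noteq> l" "j < n" "l < n"
  shows "q [^] (fact n :: nat) \<in> H"
proof -
  have "inv (p [^] i \<otimes> q [^] j) \<otimes> (p [^] i \<otimes> q [^] l) = inv (q [^] j) \<otimes> q [^] l"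
    using pq by (simp add: inv_mult_group m_assoc mult_inv_cancel)
  with mem have mem': "inv (q [^] j) \<otimes> q [^] l \<in> H" by simp
  have "\<exists>c. 0 < c \<and> c \<le> n \<and> q [^] c \<in> H"
  proof (cases "j < l")
    case True
    have "q [^] l = q [^] j \<otimes> q [^] (l - j)" using True pq by (simp add: nat_pow_mult)
    then have "q [^] (l - j) \<in> H" using mem' pq by (simp add: mult_inv_cancel)
    then show ?thesis using True jl by (intro exI[of _ "l - j"]) auto
  next
    case False
    have "q [^] j = q [^] l \<otimes> q [^] (j - l)" using False pq by (simp add: nat_pow_mult)
    then have "inv (q [^] (j - l)) \<in> H" using mem' pq by (simp add: inv_mult_group m_assoc)
    then have "q [^] (j - l) \<in> H" using H pq by (metis inv_inv nat_pow_closed subgroup.m_inv_closed)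
    then show ?thesis using False jl by (intro exI[of _ "j - l"]) auto
  qed
  then obtain c where c: "0 < c" "c \<le> n" "q [^] c \<in> H" by blast
  have pows: "(q [^] c) [^] (m::nat) \<in> H" for m
    using c H by (induction m) (auto simp: subgroup.one_closed subgroup.m_closed)
  have "c dvd (fact n :: nat)" using c by (intro dvd_fact) auto
  then obtain m where "(fact n :: nat) = c * m" by (rule dvdE)
  then show ?thesis using pows[of m] pq by (simp add: nat_pow_pow)
qed

lemma comm_group_free_abelian_of_rank: "comm_group (free_abelian_of_rank d)"
  unfolding free_abelian_of_rank_def
  by (rule group.group_comm_groupI) (auto simp: add.commute intro!: restrict_ext)

lemma coordinate_hom: "i < d \<Longrightarrow> (\<lambda>b. b i) \<in> hom (free_abelian_of_rank d) integer_group"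
  by (rule homI) (auto simp: free_abelian_of_rank_def)

lemma free_abelian_of_rank_torsion_free:
  assumes b: "b \<in> carrier (free_abelian_of_rank d)"
    and eq: "b [^]\<^bsub>free_abelian_of_rank d\<^esub> (k::nat) = \<one>\<^bsub>free_abelian_of_rank d\<^esub>"
    and k: "k > 0"
  shows "b = \<one>\<^bsub>free_abelian_of_rank d\<^esub>"
proof (rule extensionalityI[of _ "{..<d}"])
  interpret comm_group "free_abelian_of_rank d" by (rule comm_group_free_abelian_of_rank)
  show "b \<in> extensional {..<d}" "\<one>\<^bsub>free_abelian_of_rank d\<^esub> \<in> extensional {..<d}"
    using b by (auto simp: free_abelian_of_rank_def PiE_def)
  fix i assume i: "i \<in> {..<d}"
  then have "(b [^]\<^bsub>free_abelian_of_rank d\<^esub> k) i = int k * b i"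
    using hom_nat_pow[OF coordinate_hom b is_group group_integer_group] by simp
  moreover have "\<one>\<^bsub>free_abelian_of_rank d\<^esub> i = 0" using i by (simp add: free_abelian_of_rank_def)
  ultimately show "b i = \<one>\<^bsub>free_abelian_of_rank d\<^esub> i" using eq k by simp
qed

text \<open>Applied to the coordinates of Z^d, this reads off the exponents of a recurrent word and
  shows which words can lie among the lamps.\<close>

lemma integer_hom_quotient_of_powers:
  assumes "group G" and f: "f \<in> hom G integer_group" and pq: "p \<in> carrier G" "q \<in> carrier G"
  shows "f (inv\<^bsub>G\<^esub> (p [^]\<^bsub>G\<^esub> (i::nat) \<otimes>\<^bsub>G\<^esub> q [^]\<^bsub>G\<^esub> (j::nat)) \<otimes>\<^bsub>G\<^esub> (p [^]\<^bsub>G\<^esub> (k::nat) \<otimes>\<^bsub>G\<^esub> q [^]\<^bsub>G\<^esub> (l::nat)))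
      = (int k - int i) * f p + (int l - int j) * f q"
proof -
  interpret group G by fact
  interpret f: group_hom G integer_group f
    by (intro group_hom.intro group_hom_axioms.intro f is_group group_integer_group)
  show ?thesis using pq by (simp add: f.hom_nat_pow algebra_simps del: inv_mult_group)
qed

section \<open>Embedded wreath products: excluding rank at least two and infinite lamp
  groups\<close>

theorem mainTheorem15:
  fixes d :: nat
    and A :: "('a, 'm) monoid_scheme"
    and T :: "'x topology"
    and \<alpha> :: "int \<Rightarrow> 'x \<Rightarrow> 'x"
  assumes "d \<ge> 1"
    and "comm_group A"
    and "finitely_generated_group A"
    and "\<not> trivial_group A"
    and "cantor_space T"
    and "action_by_homeomorphisms integer_group T \<alpha>"
    and "embeds_into (wreath_product A (free_abelian_of_rank d))
           (topological_full_group integer_group T \<alpha>)"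
  shows "finite (carrier A) \<and> d = 1"
proof (rule ccontr)
  assume neg: "\<not> (finite (carrier A) \<and> d = 1)"
  let ?B = "free_abelian_of_rank d"
  let ?W = "wreath_product A ?B"
  let ?F = "topological_full_group integer_group T \<alpha>"
  let ?L = "kernel ?W ?B snd"
  interpret A: comm_group A by fact
  interpret B: comm_group ?B by (rule comm_group_free_abelian_of_rank)
  have tf: "\<forall>b\<in>carrier ?B. \<forall>k::nat. b [^]\<^bsub>?B\<^esub> k = \<one>\<^bsub>?B\<^esub> \<longrightarrow> k > 0 \<longrightarrow> b = \<one>\<^bsub>?B\<^esub>"
    using free_abelian_of_rank_torsion_free[of _ d] by blast
  note AB = \<open>comm_group A\<close> comm_group_free_abelian_of_rank[of d] tf
  interpret W: group ?W by (rule group_wreath_product[OF AB])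
  interpret W: torsion_free_abelian_extension ?L ?W by (rule torsion_free_abelian_extension_wreath[OF AB])

  have compact: "compact_space T"
  proof -
    have "compact_space (product_topology (\<lambda>_. discrete_topology (UNIV :: bool set)) (UNIV :: nat set))"
      by (simp add: compact_space_product_topology compact_space_discrete_topology)
    then show ?thesis using \<open>cantor_space T\<close> homeomorphic_compact_space unfolding cantor_space_def by blast
  qed
  have Z: "group_action integer_group (topspace T) \<alpha>"
    using \<open>action_by_homeomorphisms integer_group T \<alpha>\<close> by (simp add: action_by_homeomorphisms_def)
  obtain K \<theta> where K: "subgroup K ?F" and \<theta>: "\<theta> \<in> iso ?W (?F\<lparr>carrier := K\<rparr>)"
    using assms(7) unfolding embeds_into_def is_iso_def by blast
  have KF: "K \<subseteq> carrier ?F" using K by (rule subgroup.subset)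
  have \<theta>_K: "\<theta> g \<in> K" if "g \<in> carrier ?W" for g
    using \<theta> that by (auto simp: iso_def hom_def)
  have inj: "inj_on \<theta> (carrier ?W)" using \<theta> by (auto simp: iso_def bij_betw_def)
  \<comment> \<open>The embedding is read as an action on the Cantor set; its faithfulness is
    \<open>inj\<close>.\<close>
  have act: "group_action ?W (topspace T) \<theta>"
  proof (intro group_action.intro group_hom.intro group_hom_axioms.intro homI)
    show "\<theta> g \<in> carrier (BijGroup (topspace T))" if "g \<in> carrier ?W" for g
      using \<theta>_K[OF that] KF by (auto simp: topological_full_group_def BijGroup_def)
    show "\<theta> (g \<otimes>\<^bsub>?W\<^esub> h) = \<theta> g \<otimes>\<^bsub>BijGroup (topspace T)\<^esub> \<theta> h"
      if "g \<in> carrier ?W" "h \<in> carrier ?W" for g h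
      using \<theta> that by (auto simp: iso_def hom_def topological_full_group_def)
  qed (rule W.is_group group_BijGroup)+
  have growth: "\<exists>C. \<forall>x\<in>topspace T. \<exists>k. \<bar>k\<bar> \<le> C \<and> \<theta> g x = \<alpha> k x" if "g \<in> carrier ?W" for g
    using full_group_bounded_displacement[OF compact] \<theta>_K[OF that] KF by blast

  \<comment> \<open>The k-th standard basis vector of Z^d when k < d.\<close>
  let ?e = "\<lambda>k. \<lambda>i\<in>{..<d}. if i = k then 1 else 0 :: int"
  have e: "base A ?B (?e k) \<in> carrier ?W" for k
    by (rule base_closed[OF AB]) (auto simp: free_abelian_of_rank_def)
  have lamp: "lamp A ?B a \<in> ?L" if "a \<in> carrier A" for a
  proof -
    have "lamp A ?B a \<in> carrier ?W" by (rule hom_in_carrier[OF lamp_hom[OF AB] that])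
    moreover have "snd (lamp A ?B a) = \<one>\<^bsub>?B\<^esub>" by (simp only: lamp_def snd_conv)
    ultimately show ?thesis unfolding kernel_def by blast
  qed
  have coord: "(\<lambda>g. snd g i) \<in> hom ?W integer_group" if "i < d" for i
    using hom_compose[OF snd_hom[OF AB] coordinate_hom[OF that]] by (simp add: comp_def)
  have coord_L: "snd g i = 0" if "g \<in> ?L" "i < d" for g i
  proof -
    have "snd g = \<one>\<^bsub>?B\<^esub>" using that(1) unfolding kernel_def by blast
    then show ?thesis using that(2) by (simp only: free_abelian_of_rank_def one_product_group one_integer_group restrict_apply lessThan_iff if_True)
  qed
  show False
  proof (cases "d \<ge> 2")
    case True
    obtain a where a: "a \<in> carrier A" "a \<noteq> \<one>\<^bsub>A\<^esub>"
      using \<open>\<not> trivial_group A\<close> A.is_group A.one_closed by (auto simp: trivial_group_def)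
    define p q where "p = base A ?B (?e 0)" and "q = base A ?B (?e 1)"
    have pq: "p \<in> carrier ?W" "q \<in> carrier ?W" using e by (auto simp only: p_def q_def)
    obtain n :: nat where n: "\<forall>x\<in>topspace T. \<exists>i<n. \<exists>j<n. \<exists>k<n. \<exists>l<n. (i, j) \<noteq> (k, l) \<and>
        \<theta> (inv\<^bsub>?W\<^esub> (p [^]\<^bsub>?W\<^esub> i \<otimes>\<^bsub>?W\<^esub> q [^]\<^bsub>?W\<^esub> j) \<otimes>\<^bsub>?W\<^esub> (p [^]\<^bsub>?W\<^esub> k \<otimes>\<^bsub>?W\<^esub> q [^]\<^bsub>?W\<^esub> l)) x = x"
      using group_action.linear_growth_recurrence[OF act Z pq growth[OF pq(1)] growth[OF pq(2)]] by (rule exE)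
    \<comment> \<open>Coordinates 0 and 1 recover both exponent differences, so no word with
      distinct exponent pairs lies in \<open>?L\<close>. The exceptional case is vacuous, and any
      non-trivial lamp can play the role of \<open>w\<close>.\<close>
    have "lamp A ?B a = \<one>\<^bsub>?W\<^esub>"
    proof (rule W.recurrent_element_trivial[where n = n, OF act inj pq lamp[OF a(1)]])
      fix i j k l :: nat and x
      assume ne: "(i, j) \<noteq> (k, l)" and mem: "inv\<^bsub>?W\<^esub> (p [^]\<^bsub>?W\<^esub> i \<otimes>\<^bsub>?W\<^esub> q [^]\<^bsub>?W\<^esub> j) \<otimes>\<^bsub>?W\<^esub> (p [^]\<^bsub>?W\<^esub> k \<otimes>\<^bsub>?W\<^esub> q [^]\<^bsub>?W\<^esub> l) \<in> ?L"
      have c: "snd p 0 = 1" "snd q 0 = 0" "snd p 1 = 0" "snd q 1 = 1"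
        using True by (simp_all add: p_def q_def base_def)
      have d: "0 < d" "1 < d" using True by auto
      have "int k - int i = 0"
        using trans[OF sym[OF integer_hom_quotient_of_powers[OF W.is_group coord[OF d(1)] pq]] coord_L[OF mem d(1)]]
        by (simp only: c mult_1_right mult_zero_right add_0_right add_0_left)
      moreover have "int l - int j = 0"
        using trans[OF sym[OF integer_hom_quotient_of_powers[OF W.is_group coord[OF d(2)] pq]] coord_L[OF mem d(2)]]
        by (simp only: c mult_1_right mult_zero_right add_0_right add_0_left)
      ultimately have "i = k" "j = l" by auto
      with ne show "\<theta> (lamp A ?B a) x = x" by simp
    qed (use n in blast)
    from lamp_eq_one[OF this B.one_closed] a(2) show False by simp
  next
    case False
    with neg \<open>d \<ge> 1\<close> have "infinite (carrier A)" "d = 1" by auto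
    then obtain a where a: "a \<in> carrier A" "\<And>n::nat. n > 0 \<Longrightarrow> a [^]\<^bsub>A\<^esub> n \<noteq> \<one>\<^bsub>A\<^esub>"
      using A.finite_if_finite_exponents[OF \<open>finitely_generated_group A\<close>] by blast
    define p q where "p = base A ?B (?e 0)" and "q = lamp A ?B a"
    have qL: "q \<in> ?L" using lamp[OF a(1)] by (simp only: q_def)
    have pq: "p \<in> carrier ?W" "q \<in> carrier ?W" using e W.L_carrier[OF qL] by (simp_all only: p_def)
    obtain n :: nat where n: "\<forall>x\<in>topspace T. \<exists>i<n. \<exists>j<n. \<exists>k<n. \<exists>l<n. (i, j) \<noteq> (k, l) \<and>
        \<theta> (inv\<^bsub>?W\<^esub> (p [^]\<^bsub>?W\<^esub> i \<otimes>\<^bsub>?W\<^esub> q [^]\<^bsub>?W\<^esub> j) \<otimes>\<^bsub>?W\<^esub> (p [^]\<^bsub>?W\<^esub> k \<otimes>\<^bsub>?W\<^esub> q [^]\<^bsub>?W\<^esub> l)) x = x"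
      using group_action.linear_growth_recurrence[OF act Z pq growth[OF pq(1)] growth[OF pq(2)]] by (rule exE)
    \<comment> \<open>The element to be shown trivial is q^(n!). It is a lamp fixing every point
      that a recurrent word inside \<open>?L\<close> fixes, and it is non-trivial because
      \<open>a\<close> has infinite order.\<close>
    define m :: nat where "m = fact n"
    have pow: "q [^]\<^bsub>?W\<^esub> m = lamp A ?B (a [^]\<^bsub>A\<^esub> m)"
      unfolding q_def using hom_nat_pow[OF lamp_hom[OF AB] a(1) A.is_group W.is_group, of m] by (rule sym)
    have "lamp A ?B (a [^]\<^bsub>A\<^esub> m) = \<one>\<^bsub>?W\<^esub>"
    proof (rule W.recurrent_element_trivial[where n = n, OF act inj pq lamp[OF A.nat_pow_closed[OF a(1)]]])
      fix i j k l :: nat and x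
      let ?t = "inv\<^bsub>?W\<^esub> (p [^]\<^bsub>?W\<^esub> i \<otimes>\<^bsub>?W\<^esub> q [^]\<^bsub>?W\<^esub> j) \<otimes>\<^bsub>?W\<^esub> (p [^]\<^bsub>?W\<^esub> k \<otimes>\<^bsub>?W\<^esub> q [^]\<^bsub>?W\<^esub> l)"
      assume lt: "j < n" "l < n" and ne: "(i, j) \<noteq> (k, l)" and x: "x \<in> topspace T"
        and mem: "?t \<in> ?L" and fixed: "\<theta> ?t x = x"
      have d: "0 < d" using \<open>d \<ge> 1\<close> by simp
      have c: "snd p 0 = 1" "snd q 0 = 0"
        using d coord_L[OF qL d] by (simp_all add: p_def base_def)
      have "int k - int i = 0"
        using trans[OF sym[OF integer_hom_quotient_of_powers[OF W.is_group coord[OF d] pq]] coord_L[OF mem d]]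
        by (simp only: c mult_1_right mult_zero_right add_0_right add_0_left)
      \<comment> \<open>Membership in \<open>?L\<close> controls only the powers of
        \<open>p\<close>, since \<open>q\<close> is itself a lamp; the word is therefore a power of
        \<open>q\<close>.\<close>
      then have ik: "i = k" by simp
      have "?t \<in> stabilizer ?W \<theta> x"
        using fixed W.L_carrier[OF mem] unfolding stabilizer_def by blast
      then have "q [^]\<^bsub>?W\<^esub> m \<in> stabilizer ?W \<theta> x"
        using W.fact_pow_mem_subgroup[OF pq group_action.stabilizer_subgroup[OF act x], of i j l n] ne lt
        unfolding ik m_def by blast
      then show "\<theta> (lamp A ?B (a [^]\<^bsub>A\<^esub> m)) x = x"
        unfolding pow stabilizer_def by blast
    qed (use n in blast)
    then have "a [^]\<^bsub>A\<^esub> m = \<one>\<^bsub>A\<^esub>" by (rule lamp_eq_one[OF _ B.one_closed])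
    then show False using a(2)[of m] by (simp add: m_def)
  qed
qed

end
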